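(* Let $\mathbb{K}$ be a field. For almost all graphs $G$, the graded artinian ring $$R/(I(G)+\langle x_1^{a_1},\ldots,x_n^{a_n}\rangle),\qquad R=\mathbb{K}[x_1,\ldots,x_n],$$ is not level for any choice of $(a_1,\ldots,a_n)\in\mathbb{N}^n$ with $a_i\geq 2$ for all $i$. That is, for every fixed $p\in(0,1)$, if $G$ is a random graph of order $n$ with edge probability $p$, then the probability that $R/(I(G)+\langle x_1^{a_1},\ldots,x_n^{a_n}\rangle)$ fails to be level for every $(a_1,\ldots,a_n)\in\mathbb{N}^n$ with all $a_i\geq 2$ tends to $1$ as $n\to\infty$.
   Context: A random graph of order $n$ (with fixed $p\in(0,1)$) is a graph on $\{x_1,\ldots,x_n\}$ in which each pair $\{x_i,x_j\}$, $1\leq i<j\leq n$, is an edge independently with probability $p$. "Almost all graphs have property $P$" means that for every $0<p<1$, $\mathrm{Prob}(G \text{ has property } P)\to 1$ as $n=|V|\to\infty$. The edge ideal of $G$ is $I(G)=\langle x_ix_j : \{x_i,x_j\}\in E(G)\rangle\subseteq R$. A graded algebra $A=\mathbb{K}[x_1,\ldots,x_n]/I$ ($I$ a homogeneous ideal) is artinian if its Krull dimension is $0$; then $A=A_0\oplus\cdots\oplus A_e$ with $A_e\neq 0$. Its socle is $\mathrm{soc}(A)=\{a\in A : a\overline{x}_i=0 \text{ for } i=1,\ldots,n\}$ and $A$ is level if $\dim_{\mathbb{K}}\mathrm{soc}(A)_i=0$ for all $i<e$ (and so $\dim_{\mathbb{K}}\mathrm{soc}(A)_e>0$). *)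

theory Defs
  imports
    "HOL-Algebra.QuotRing"
    "HOL-Algebra.Embedded_Algebras"
    "HOL-Library.Poly_Mapping"
    "HOL-Probability.Product_PMF"
begin

section \<open>Random graphs\<close>

text \<open>A graph of order \<open>n\<close> has vertex set \<open>{1..n}\<close>, the vertex \<open>i\<close> standing for the variable
  \<open>x_i\<close>, and is given by its set of edges, which are two-element sets of vertices.\<close>

definition vertex_pairs :: "nat \<Rightarrow> nat set set" where
  "vertex_pairs n = {{i, j} | i j. 1 \<le> i \<and> i < j \<and> j \<le> n}"

text \<open>The product distribution makes one independent Bernoulli trial for each pair of vertices.\<close>

definition random_graph :: "nat \<Rightarrow> real \<Rightarrow> nat set set pmf" where
  "random_graph n p =
     map_pmf (\<lambda>\<omega>. {e \<in> vertex_pairs n. \<omega> e})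
       (Pi_pmf (vertex_pairs n) False (\<lambda>_. bernoulli_pmf p))"


section \<open>The polynomial ring in finitely many variables\<close>

text \<open>Since the number of variables varies, the ring in the variables \<open>x_1, \<dots>, x_n\<close> is a carrier
  inside one type of polynomials in countably many variables: a monomial is a finitely
  supported exponent function, a polynomial a finitely supported coefficient function.\<close>

type_synonym 'k mpoly = "(nat \<Rightarrow>\<^sub>0 nat) \<Rightarrow>\<^sub>0 'k"

definition polynomial_ring :: "nat \<Rightarrow> ('k::field) mpoly ring" where
  "polynomial_ring n =
     \<lparr>carrier = {f. \<forall>m \<in> Poly_Mapping.keys f. Poly_Mapping.keys m \<subseteq> {1..n}},
      monoid.mult = (*), one = 1, zero = 0, add = (+)\<rparr>"

definition const :: "'k::field \<Rightarrow> 'k mpoly" where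
  "const c = Poly_Mapping.single 0 c"

definition var :: "nat \<Rightarrow> ('k::field) mpoly" where
  "var i = Poly_Mapping.single (Poly_Mapping.single i 1) 1"

definition monomial_degree :: "(nat \<Rightarrow>\<^sub>0 nat) \<Rightarrow> nat" where
  "monomial_degree m = (\<Sum>i \<in> Poly_Mapping.keys m. Poly_Mapping.lookup m i)"

definition homogeneous :: "nat \<Rightarrow> ('k::field) mpoly \<Rightarrow> bool" where
  "homogeneous d f \<longleftrightarrow> (\<forall>m \<in> Poly_Mapping.keys f. monomial_degree m = d)"

lemma cring_polynomial_ring: "cring (polynomial_ring n :: ('k::field) mpoly ring)"
proof (rule cringI)
  show "abelian_group (polynomial_ring n :: 'k mpoly ring)"
  proof (rule abelian_groupI, goal_cases)
    case (6 x)
    then show ?case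
      by (intro bexI[of _ "- x"]) (auto simp: polynomial_ring_def)
  qed (use keys_add in \<open>fastforce simp: polynomial_ring_def algebra_simps\<close>)+
  show "comm_monoid (polynomial_ring n :: 'k mpoly ring)"
  proof (rule comm_monoidI, goal_cases)
    case (1 f g)
    show ?case
    proof (simp add: polynomial_ring_def, intro ballI)
      fix m assume "m \<in> Poly_Mapping.keys (f * g)"
      then obtain a b where "m = a + b" "a \<in> Poly_Mapping.keys f" "b \<in> Poly_Mapping.keys g"
        using keys_mult[of f g] by blast
      then show "Poly_Mapping.keys m \<subseteq> {Suc 0..n}"
        using 1 keys_add[of a b] by (fastforce simp: polynomial_ring_def)
    qed
  qed (auto simp: polynomial_ring_def algebra_simps)
qed (auto simp: polynomial_ring_def algebra_simps)


section \<open>Graded quotients of the polynomial ring\<close>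

definition edge_ideal :: "nat \<Rightarrow> nat set set \<Rightarrow> ('k::field) mpoly set" where
  "edge_ideal n E = Idl\<^bsub>polynomial_ring n\<^esub> {var i * var j | i j. {i, j} \<in> E}"

definition power_ideal :: "nat \<Rightarrow> (nat \<Rightarrow> nat) \<Rightarrow> ('k::field) mpoly set" where
  "power_ideal n a = Idl\<^bsub>polynomial_ring n\<^esub> {var i ^ a i | i. i \<in> {1..n}}"

text \<open>In the following, \<open>I\<close> is a homogeneous ideal of \<^term>\<open>polynomial_ring n\<close>; the residue
  class of \<open>f\<close> is its coset.\<close>

abbreviation quotient_algebra :: "nat \<Rightarrow> ('k::field) mpoly set \<Rightarrow> 'k mpoly set ring" where
  "quotient_algebra n I \<equiv> polynomial_ring n Quot I"

abbreviation residue :: "nat \<Rightarrow> ('k::field) mpoly set \<Rightarrow> 'k mpoly \<Rightarrow> 'k mpoly set" where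
  "residue n I f \<equiv> I +>\<^bsub>polynomial_ring n\<^esub> f"

definition scalars :: "nat \<Rightarrow> ('k::field) mpoly set \<Rightarrow> 'k mpoly set set" where
  "scalars n I = range (\<lambda>c. residue n I (const c))"

definition graded_component :: "nat \<Rightarrow> ('k::field) mpoly set \<Rightarrow> nat \<Rightarrow> 'k mpoly set set" where
  "graded_component n I d =
     residue n I ` {f \<in> carrier (polynomial_ring n). homogeneous d f}"

definition socle :: "nat \<Rightarrow> ('k::field) mpoly set \<Rightarrow> 'k mpoly set set" where
  "socle n I =
     {s \<in> carrier (quotient_algebra n I).
        \<forall>i \<in> {1..n}. s \<otimes>\<^bsub>quotient_algebra n I\<^esub> residue n I (var i) = \<zero>\<^bsub>quotient_algebra n I\<^esub>}"

definition top_degree :: "nat \<Rightarrow> ('k::field) mpoly set \<Rightarrow> nat \<Rightarrow> bool" where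
  "top_degree n I e \<longleftrightarrow>
     graded_component n I e \<noteq> {\<zero>\<^bsub>quotient_algebra n I\<^esub>} \<and>
     (\<forall>d > e. graded_component n I d = {\<zero>\<^bsub>quotient_algebra n I\<^esub>})"

text \<open>Levelness is a notion for artinian quotients, for which there is exactly one top degree
  \<open>e\<close> (unless the quotient is zero). Because \<open>e\<close> is bound universally here, the negation of
  levelness asserts that the top degree exists and that the socle is nonzero in a smaller degree.\<close>

definition level :: "nat \<Rightarrow> ('k::field) mpoly set \<Rightarrow> bool" where
  "level n I \<longleftrightarrow>
     (\<forall>e. top_degree n I e \<longrightarrow>
       (\<forall>i < e. ring.dimension (quotient_algebra n I) 0 (scalars n I)
                  (socle n I \<inter> graded_component n I i)))"

end

theory Submission
  imports Defs "HOL-Real_Asymp.Real_Asymp"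
begin

text \<open>The socle of the quotient is spanned by the monomials whose support is a maximal independent set
  \<open>M\<close> of the graph, with the exponent \<open>a i - 1\<close> at each \<open>i \<in> M\<close>. A level quotient therefore gives all
  maximal independent sets the same weight for the positive weights \<open>a i - 1\<close>. This is impossible
  if some independent set dominates all vertices except those of an induced path on five vertices.
  The second moment method shows that almost every graph contains an induced path together with an
  independent set of about \<open>1.2 log n\<close> vertices (to base \<open>1 / (1 - p)\<close>) of this kind.\<close>


section \<open>Monomial ideals\<close>

text \<open>The exponents are chosen after the graph, and there are infinitely many choices, so a
  single configuration has to defeat all positive weights at once. Two maximal independent sets of
  different cardinality would not do, because suitable weights can balance them. The path on five
  vertices is the shortest path whose maximal independent sets admit no common positive weight: on
  four vertices all of them have two elements, and on three the middle vertex can carry the sum of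
  the other two weights. When an independent set S has no edge to the path and dominates everything
  else, the maximal independent sets containing S are exactly S joined with those of the path, so
  the weight of S cancels. Domination depends on all edges from S to the rest of the graph, and for
  two overlapping candidates the joint event is awkward to compute. It therefore enters only the
  expected number of good candidates, while correlations are bounded for the events that prescribe
  the pairs inside a candidate.\<close>

abbreviation monomial :: "(nat \<Rightarrow>\<^sub>0 nat) \<Rightarrow> ('k::field) mpoly" where
  "monomial m \<equiv> Poly_Mapping.single m 1"

text \<open>Meant for sets \<open>J\<close> that are closed under adding exponents. \<open>J\<close>
  may mention variables beyond the \<open>n\<close>-th one; the carrier cuts them off.\<close>

definition monomial_ideal :: "nat \<Rightarrow> (nat \<Rightarrow>\<^sub>0 nat) set \<Rightarrow> ('k::field) mpoly set" where
  "monomial_ideal n J = {f \<in> carrier (polynomial_ring n). Poly_Mapping.keys f \<subseteq> J}"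

lemma polynomial_ring_a_inv:
  assumes "f \<in> carrier (polynomial_ring n)"
  shows "\<ominus>\<^bsub>polynomial_ring n\<^esub> f = - (f :: ('k::field) mpoly)"
proof -
  interpret cring "polynomial_ring n :: 'k mpoly ring" by (rule cring_polynomial_ring)
  show ?thesis
    by (rule minus_equality) (use assms in \<open>auto simp: polynomial_ring_def\<close>)
qed

lemma ideal_monomial_ideal:
  assumes up: "\<And>m m'. m \<in> J \<Longrightarrow> m + m' \<in> J"
  shows "ideal (monomial_ideal n J) (polynomial_ring n :: ('k::field) mpoly ring)"
proof -
  interpret cring "polynomial_ring n :: 'k mpoly ring" by (rule cring_polynomial_ring)
  show ?thesis
  proof (rule idealI)
    show "ring (polynomial_ring n :: 'k mpoly ring)" by (rule ring_axioms)
    show "subgroup (monomial_ideal n J) (add_monoid (polynomial_ring n :: 'k mpoly ring))"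
    proof (rule add.subgroupI)
      fix f g :: "'k mpoly" assume "f \<in> monomial_ideal n J" "g \<in> monomial_ideal n J"
      then show "f \<oplus>\<^bsub>polynomial_ring n\<^esub> g \<in> monomial_ideal n J"
        using add.m_closed[of f g] order.trans[OF keys_add[of f g], of J]
        by (simp add: monomial_ideal_def polynomial_ring_def)
    next
      fix f :: "'k mpoly" assume "f \<in> monomial_ideal n J"
      then show "\<ominus>\<^bsub>polynomial_ring n\<^esub> f \<in> monomial_ideal n J"
        using a_inv_closed[of f] by (auto simp: monomial_ideal_def polynomial_ring_a_inv)
    next
      have "(0 :: 'k mpoly) \<in> monomial_ideal n J"
        by (simp add: monomial_ideal_def polynomial_ring_def)
      then show "monomial_ideal n J \<noteq> ({} :: 'k mpoly set)" by blast
    qed (auto simp: monomial_ideal_def)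
  next
    fix f g :: "'k mpoly"
    assume f: "f \<in> monomial_ideal n J" and g: "g \<in> carrier (polynomial_ring n)"
    have "Poly_Mapping.keys (g * f) \<subseteq> J"
      using keys_mult[of f g] f up by (fastforce simp: monomial_ideal_def mult.commute)
    then show "g \<otimes>\<^bsub>polynomial_ring n\<^esub> f \<in> monomial_ideal n J"
      using m_closed[OF g, of f] f by (auto simp: monomial_ideal_def polynomial_ring_def)
    then show "f \<otimes>\<^bsub>polynomial_ring n\<^esub> g \<in> monomial_ideal n J"
      using f g m_comm[of f g] by (auto simp: monomial_ideal_def)
  qed
qed

text \<open>Each term of \<open>f\<close> is a constant times a monomial of the ideal. The induction
  runs over subsets of the keys, with the coefficients of \<open>f\<close> held fixed.\<close>

lemma mem_ideal_if_monomials_mem: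
  fixes f :: "('k::field) mpoly"
  assumes I: "ideal I (polynomial_ring n)" and f: "f \<in> carrier (polynomial_ring n)"
    and mon: "\<And>m. m \<in> Poly_Mapping.keys f \<Longrightarrow> monomial m \<in> I"
  shows "f \<in> I"
proof -
  interpret ideal I "polynomial_ring n" by (rule I)
  have "(\<Sum>m\<in>A. Poly_Mapping.single m (Poly_Mapping.lookup f m)) \<in> I"
    if "finite A" "A \<subseteq> Poly_Mapping.keys f" for A
    using that
  proof (induction rule: finite_induct)
    case empty
    show ?case
      using additive_subgroup.zero_closed[OF ideal.axioms(1)[OF I]] by (simp add: polynomial_ring_def)
  next
    case (insert m A)
    have "const (Poly_Mapping.lookup f m) \<in> carrier (polynomial_ring n)"
      by (simp add: const_def polynomial_ring_def)
    then have "const (Poly_Mapping.lookup f m) * monomial m \<in> I"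
      using I_l_closed[of "monomial m" "const (Poly_Mapping.lookup f m)"] mon insert.prems
      by (simp add: polynomial_ring_def)
    then have "Poly_Mapping.single m (Poly_Mapping.lookup f m) \<in> I"
      by (simp add: const_def mult_single)
    then show ?case
      using insert additive_subgroup.a_closed[OF ideal.axioms(1)[OF I], of "Poly_Mapping.single m (Poly_Mapping.lookup f m)"
          "\<Sum>m\<in>A. Poly_Mapping.single m (Poly_Mapping.lookup f m)"]
      by (simp add: polynomial_ring_def)
  qed
  then have "(\<Sum>m\<in>Poly_Mapping.keys f. Poly_Mapping.single m (Poly_Mapping.lookup f m)) \<in> I"
    by simp
  moreover have "(\<Sum>m\<in>Poly_Mapping.keys f. Poly_Mapping.single m (Poly_Mapping.lookup f m)) = f"
    by (rule poly_mapping_eqI)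
      (auto simp: lookup_sum lookup_single when_def in_keys_iff)
  ultimately show ?thesis by simp
qed


section \<open>Edge ideals with powers of the variables\<close>

text \<open>The exponents of the monomials divisible by a generator: divisibility by an edge shows
  in the support, divisibility by a pure power in a single exponent.\<close>

definition edge_power_monomials :: "nat \<Rightarrow> nat set set \<Rightarrow> (nat \<Rightarrow> nat) \<Rightarrow> (nat \<Rightarrow>\<^sub>0 nat) set" where
  "edge_power_monomials n E a =
     {m. (\<exists>i j. {i, j} \<in> E \<and> i \<noteq> j \<and> i \<in> Poly_Mapping.keys m \<and> j \<in> Poly_Mapping.keys m)
       \<or> (\<exists>i\<in>{1..n}. a i \<le> Poly_Mapping.lookup m i)}"

lemma edge_power_monomials_add:
  "m \<in> edge_power_monomials n E a \<Longrightarrow> m + m' \<in> edge_power_monomials n E a"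
  unfolding edge_power_monomials_def
  by (auto simp: in_keys_iff lookup_add intro: trans_le_add1)

lemma var_power: "var i ^ k = (monomial (Poly_Mapping.single i k) :: ('k::field) mpoly)"
  by (induction k) (simp_all add: var_def mult_single flip: single_add)

lemma var_mult_var:
  "var i * var j
     = (monomial (Poly_Mapping.single i 1 + Poly_Mapping.single j 1) :: ('k::field) mpoly)"
  by (simp add: var_def mult_single)

lemma monomial_carrier_iff:
  "(monomial m :: ('k::field) mpoly) \<in> carrier (polynomial_ring n)
     \<longleftrightarrow> Poly_Mapping.keys m \<subseteq> {1..n}"
  by (simp add: polynomial_ring_def)

lemma vertex_pairs_doubleton:
  "{i, j} \<in> vertex_pairs n \<Longrightarrow> i \<noteq> j \<and> i \<in> {1..n} \<and> j \<in> {1..n}"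
  by (auto simp: vertex_pairs_def doubleton_eq_iff)

text \<open>Both summands are generated by monomials, so membership is a test on each monomial
  separately: the generators pass it, the test defines an ideal, and every monomial passing it is a
  multiple of a generator.\<close>

lemma
  fixes n :: nat and E :: "nat set set" and a :: "nat \<Rightarrow> nat"
  assumes E: "E \<subseteq> vertex_pairs n"
  defines "R \<equiv> polynomial_ring n :: ('k::field) mpoly ring"
  shows edge_power_ideal: "edge_ideal n E <+>\<^bsub>R\<^esub> power_ideal n a
      = monomial_ideal n (edge_power_monomials n E a)" (is "?I = ?J")
    and ideal_edge_power_ideal: "ideal (edge_ideal n E <+>\<^bsub>R\<^esub> power_ideal n a) R"
proof -
  interpret cring R unfolding R_def by (rule cring_polynomial_ring)
  let ?GE = "{var i * var j | i j. {i, j} \<in> E} :: 'k mpoly set"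
  let ?GP = "{var i ^ a i | i. i \<in> {1..n}} :: 'k mpoly set"
  have GEJ: "?GE \<subseteq> ?J"
  proof safe
    fix i j assume "{i, j} \<in> E"
    moreover from this have ij: "i \<noteq> j" "i \<in> {1..n}" "j \<in> {1..n}"
      using E vertex_pairs_doubleton by blast+
    moreover from ij have "Poly_Mapping.keys (Poly_Mapping.single i 1 + Poly_Mapping.single j (1::nat)) = {i, j}"
      by (auto simp: in_keys_iff lookup_add lookup_single when_def split: if_splits)
    ultimately show "var i * var j \<in> ?J"
      by (auto simp: var_mult_var monomial_ideal_def edge_power_monomials_def monomial_carrier_iff)
  qed
  have GPJ: "?GP \<subseteq> ?J"
    by (auto simp: var_power monomial_ideal_def edge_power_monomials_def monomial_carrier_iff
        lookup_single when_def split: if_splits)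
  have J: "ideal ?J R"
    unfolding R_def by (intro ideal_monomial_ideal edge_power_monomials_add)
  then interpret J: ideal ?J R .
  have GE: "?GE \<subseteq> carrier R" and GP: "?GP \<subseteq> carrier R"
    using GEJ GPJ J.a_subset by auto
  have idE: "ideal (edge_ideal n E) R" and idP: "ideal (power_ideal n a) R"
    using genideal_ideal[OF GE] genideal_ideal[OF GP]
    by (auto simp: edge_ideal_def power_ideal_def R_def)
  then show idI: "ideal ?I R" by (rule add_ideals)
  interpret I: ideal ?I R by (rule idI)
  interpret IE: ideal "edge_ideal n E" R by (rule idE)
  interpret IP: ideal "power_ideal n a" R by (rule idP)
  have IEI: "edge_ideal n E \<subseteq> ?I"
  proof
    fix x :: "'k mpoly" assume x: "x \<in> edge_ideal n E"
    have "x = x \<oplus>\<^bsub>R\<^esub> \<zero>\<^bsub>R\<^esub>" using IE.a_Hcarr[OF x] by simp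
    then show "x \<in> ?I"
      unfolding set_add_def' using x additive_subgroup.zero_closed[OF ideal.axioms(1)[OF idP]] by blast
  qed
  have IPI: "power_ideal n a \<subseteq> ?I"
  proof
    fix x :: "'k mpoly" assume x: "x \<in> power_ideal n a"
    have "x = \<zero>\<^bsub>R\<^esub> \<oplus>\<^bsub>R\<^esub> x" using IP.a_Hcarr[OF x] by simp
    then show "x \<in> ?I"
      unfolding set_add_def' using x additive_subgroup.zero_closed[OF ideal.axioms(1)[OF idE]] by blast
  qed
  have GEI: "?GE \<subseteq> ?I"
    using subset_trans[OF genideal_self[OF GE]] IEI unfolding edge_ideal_def R_def .
  have GPI: "?GP \<subseteq> ?I"
    using subset_trans[OF genideal_self[OF GP]] IPI unfolding power_ideal_def R_def .
  show "?I = ?J"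
  proof
    have "edge_ideal n E \<subseteq> ?J" "power_ideal n a \<subseteq> ?J"
      using genideal_minimal[OF J GEJ] genideal_minimal[OF J GPJ]
      by (auto simp: edge_ideal_def power_ideal_def R_def)
    then show "?I \<subseteq> ?J"
      using additive_subgroup.a_closed[OF ideal.axioms(1)[OF J]] by (auto simp: set_add_def')
  next
    show "?J \<subseteq> ?I"
    proof
      fix f :: "'k mpoly" assume f: "f \<in> ?J"
      show "f \<in> ?I"
      proof (rule mem_ideal_if_monomials_mem[of _ n])
        show "ideal ?I (polynomial_ring n)" using idI by (simp add: R_def)
        show "f \<in> carrier (polynomial_ring n)" using f by (simp add: monomial_ideal_def)
        fix m assume m: "m \<in> Poly_Mapping.keys f"
        have mn: "Poly_Mapping.keys m \<subseteq> {1..n}" and mJ: "m \<in> edge_power_monomials n E a"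
          using f m by (auto simp: monomial_ideal_def polynomial_ring_def)
        \<comment> \<open>Subtraction of exponents is truncated; \<open>le\<close> is what makes
          \<open>m - g\<close> a genuine cofactor.\<close>
        have mult: "(monomial m :: 'k mpoly) \<in> ?I"
          if g: "(monomial g :: 'k mpoly) \<in> ?I"
            and le: "\<And>i. Poly_Mapping.lookup g i \<le> Poly_Mapping.lookup m i" for g
        proof -
          have eq: "g + (m - g) = m"
            by (rule poly_mapping_eqI) (simp add: lookup_add lookup_minus le)
          have "Poly_Mapping.keys (m - g) \<subseteq> {1..n}"
            using mn by (auto simp: in_keys_iff lookup_minus)
          then have "(monomial (m - g) :: 'k mpoly) \<in> carrier R"
            by (simp add: R_def monomial_carrier_iff)
          from I.I_r_closed[OF g this] show ?thesis
            by (simp add: R_def polynomial_ring_def mult_single eq)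
        qed
        from mJ consider i j where "{i, j} \<in> E" "i \<noteq> j"
            "i \<in> Poly_Mapping.keys m" "j \<in> Poly_Mapping.keys m"
          | i where "i \<in> {1..n}" "a i \<le> Poly_Mapping.lookup m i"
          unfolding edge_power_monomials_def by blast
        then show "monomial m \<in> ?I"
        proof cases
          case 1
          have "var i * var j \<in> ?I" using GEI 1(1) by blast
          then show ?thesis
            using 1 by (intro mult[of "Poly_Mapping.single i 1 + Poly_Mapping.single j 1"])
              (auto simp: var_mult_var lookup_add lookup_single when_def in_keys_iff)
        next
          case 2
          have "var i ^ a i \<in> ?I" using GPI 2(1) by blast
          then show ?thesis
            using 2 by (intro mult[of "Poly_Mapping.single i (a i)"])
              (auto simp: var_power lookup_single when_def)
        qed
      qed
    qed
  qed
qed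


section \<open>Vanishing of residues and of graded components\<close>

lemma residue_eq_zero_iff:
  fixes f :: "('k::field) mpoly"
  assumes I: "ideal I (polynomial_ring n)" and f: "f \<in> carrier (polynomial_ring n)"
  shows "residue n I f = \<zero>\<^bsub>quotient_algebra n I\<^esub> \<longleftrightarrow> f \<in> I"
proof -
  interpret ideal I "polynomial_ring n" by (rule I)
  show ?thesis
    using rcos_const_imp_mem[OF f] a_rcos_zero[OF I] by (auto simp: FactRing_def)
qed

lemma graded_component_trivial_iff:
  fixes I :: "('k::field) mpoly set"
  assumes I: "ideal I (polynomial_ring n)"
  shows "graded_component n I d = {\<zero>\<^bsub>quotient_algebra n I\<^esub>}
    \<longleftrightarrow> (\<forall>f \<in> carrier (polynomial_ring n). homogeneous d f \<longrightarrow> f \<in> I)"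
proof -
  \<comment> \<open>The zero polynomial is homogeneous of every degree, so a component always
    contains the zero residue and is never the empty set.\<close>
  have z: "(0 :: 'k mpoly) \<in> carrier (polynomial_ring n)" "homogeneous d (0 :: 'k mpoly)"
    by (auto simp: polynomial_ring_def homogeneous_def)
  show ?thesis
    unfolding graded_component_def using residue_eq_zero_iff[OF I] z by blast
qed


section \<open>Maximal independent sets\<close>

text \<open>Maximality is expressed as domination, which is the form that shows annihilation by the
  variables outside \<open>M\<close>.\<close>

definition maximal_independent :: "nat \<Rightarrow> nat set set \<Rightarrow> nat set \<Rightarrow> bool" where
  "maximal_independent n E M \<longleftrightarrow> M \<subseteq> {1..n} \<and> (\<forall>i\<in>M. \<forall>j\<in>M. {i, j} \<notin> E) \<and>
     (\<forall>v\<in>{1..n} - M. \<exists>i\<in>M. {i, v} \<in> E)"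

text \<open>The witness has exponent \<open>a i - 1\<close> on \<open>M\<close>, which is positive,
  so its support is exactly \<open>M\<close>. Multiplying by a variable in \<open>M\<close> reaches
  the forbidden power; multiplying by one outside \<open>M\<close> puts an edge into the
  support.\<close>

lemma socle_monomial:
  fixes E :: "nat set set" and a :: "nat \<Rightarrow> nat"
  assumes M: "maximal_independent n E M" and E: "E \<subseteq> vertex_pairs n"
    and a: "\<forall>i\<in>{1..n}. 2 \<le> a i"
  defines "J \<equiv> edge_power_monomials n E a"
  shows "\<exists>m. Poly_Mapping.keys m \<subseteq> {1..n} \<and> m \<notin> J \<and> monomial_degree m = (\<Sum>i\<in>M. a i - 1) \<and>
    (\<forall>i\<in>{1..n}. m + Poly_Mapping.single i 1 \<in> J)"
proof (intro exI conjI)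
  let ?m = "\<Sum>i\<in>M. Poly_Mapping.single i (a i - 1)"
  have Mn: "M \<subseteq> {1..n}" and ind: "\<And>i j. i \<in> M \<Longrightarrow> j \<in> M \<Longrightarrow> {i, j} \<notin> E"
    and dom: "\<And>v. v \<in> {1..n} - M \<Longrightarrow> \<exists>i\<in>M. {i, v} \<in> E"
    using M by (auto simp: maximal_independent_def)
  have fin: "finite M" using Mn finite_subset by blast
  have lookup: "Poly_Mapping.lookup ?m i = (if i \<in> M then a i - 1 else 0)" for i
    using fin by (simp add: lookup_sum lookup_single when_def)
  have a2: "2 \<le> a i" if "i \<in> M" for i using a Mn that by auto
  have keys: "Poly_Mapping.keys ?m = M"
  proof (rule Set.set_eqI)
    fix i show "i \<in> Poly_Mapping.keys ?m \<longleftrightarrow> i \<in> M"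
      using a2[of i] lookup[of i] by (auto simp: in_keys_iff simp del: One_nat_def)
  qed
  show "Poly_Mapping.keys ?m \<subseteq> {1..n}" using Mn keys by simp
  show "monomial_degree ?m = (\<Sum>i\<in>M. a i - 1)"
    unfolding monomial_degree_def keys by (simp add: lookup del: One_nat_def)
  have "\<not> a i \<le> Poly_Mapping.lookup ?m i" if "i \<in> {1..n}" for i
    using bspec[OF a that] lookup[of i] by (auto simp del: One_nat_def)
  then show "?m \<notin> J"
    using ind unfolding J_def edge_power_monomials_def mem_Collect_eq keys by blast
  show "\<forall>i\<in>{1..n}. ?m + Poly_Mapping.single i 1 \<in> J"
  proof
    fix i assume i: "i \<in> {1..n}"
    show "?m + Poly_Mapping.single i 1 \<in> J"
    proof (cases "i \<in> M")
      case True
      then have "a i \<le> Poly_Mapping.lookup (?m + Poly_Mapping.single i 1) i"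
        using lookup[of i] by (simp add: lookup_add del: One_nat_def)
      then show ?thesis using i unfolding J_def edge_power_monomials_def by blast
    next
      case False
      then obtain j where j: "j \<in> M" "{j, i} \<in> E" using dom i by blast
      have "j \<in> Poly_Mapping.keys (?m + Poly_Mapping.single i 1)"
        using j(1) keys by (auto simp: in_keys_iff lookup_add)
      moreover have "i \<in> Poly_Mapping.keys (?m + Poly_Mapping.single i 1)"
        by (simp add: in_keys_iff lookup_add)
      moreover have "j \<noteq> i" using j False by blast
      ultimately show ?thesis using j unfolding J_def edge_power_monomials_def by blast
    qed
  qed
qed

text \<open>A crude bound, there to make the set of degrees with nonzero component finite.\<close>

lemma monomial_degree_bound:
  assumes "Poly_Mapping.keys m \<subseteq> {1..n}" "m \<notin> edge_power_monomials n E a"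
  shows "monomial_degree m \<le> (\<Sum>i=1..n. a i)"
proof -
  have "\<And>i. i \<in> {1..n} \<Longrightarrow> Poly_Mapping.lookup m i \<le> a i"
    using assms(2) unfolding edge_power_monomials_def by (auto simp: not_le less_imp_le)
  then have "monomial_degree m \<le> (\<Sum>i\<in>Poly_Mapping.keys m. a i)"
    unfolding monomial_degree_def using assms(1) by (intro sum_mono) auto
  also have "\<dots> \<le> (\<Sum>i=1..n. a i)"
    using assms(1) by (intro sum_mono2) auto
  finally show ?thesis .
qed

text \<open>The monomial of the heavier set \<open>M'\<close> is nonzero and forces the top degree
  above the degree of the socle monomial belonging to \<open>M\<close>.\<close>

lemma not_level_edge_power_ideal:
  fixes E :: "nat set set" and a :: "nat \<Rightarrow> nat"
  assumes E: "E \<subseteq> vertex_pairs n" and a: "\<forall>i\<in>{1..n}. 2 \<le> a i"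
    and M: "maximal_independent n E M" and M': "maximal_independent n E M'"
    and less: "(\<Sum>i\<in>M. a i - 1) < (\<Sum>i\<in>M'. a i - 1)"
  shows "\<not> level n (edge_ideal n E <+>\<^bsub>polynomial_ring n\<^esub> power_ideal n a :: ('k::field) mpoly set)"
proof -
  define I :: "'k mpoly set" where "I = edge_ideal n E <+>\<^bsub>polynomial_ring n\<^esub> power_ideal n a"
  define J where "J = edge_power_monomials n E a"
  have I_eq: "I = monomial_ideal n J"
    unfolding I_def J_def using edge_power_ideal[OF E] .
  have mem_I: "f \<in> I \<longleftrightarrow> f \<in> carrier (polynomial_ring n) \<and> Poly_Mapping.keys f \<subseteq> J" for f
    by (simp add: I_eq monomial_ideal_def)
  have monomial_mem_I: "monomial m \<in> I \<longleftrightarrow> Poly_Mapping.keys m \<subseteq> {1..n} \<and> m \<in> J" for m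
    unfolding mem_I monomial_carrier_iff by simp
  have idI: "ideal I (polynomial_ring n)"
    unfolding I_def using ideal_edge_power_ideal[OF E] .
  \<comment> \<open>Without a top degree \<open>level\<close> would hold vacuously, so one has to be
    exhibited: the maximum of the finite nonempty set \<open>D\<close>.\<close>
  define D where "D = {d. graded_component n I d \<noteq> {\<zero>\<^bsub>quotient_algebra n I\<^esub>}}"
  have D_iff: "d \<in> D \<longleftrightarrow> (\<exists>f \<in> carrier (polynomial_ring n). homogeneous d f \<and> f \<notin> I)" for d
    unfolding D_def mem_Collect_eq graded_component_trivial_iff[OF idI] by blast
  have D_bound: "d \<le> (\<Sum>i=1..n. a i)" if d: "d \<in> D" for d
  proof -
    obtain f :: "'k mpoly" where f: "f \<in> carrier (polynomial_ring n)" "homogeneous d f" "f \<notin> I"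
      using d unfolding D_iff by blast
    then obtain m where m: "m \<in> Poly_Mapping.keys f" "m \<notin> J" unfolding mem_I by blast
    then have "Poly_Mapping.keys m \<subseteq> {1..n}"
      using f(1) by (simp add: polynomial_ring_def)
    then have "monomial_degree m \<le> (\<Sum>i=1..n. a i)"
      using m(2) unfolding J_def by (rule monomial_degree_bound)
    then show ?thesis using f(2) m(1) by (simp add: homogeneous_def)
  qed
  then have finD: "finite D" unfolding finite_nat_set_iff_bounded_le by blast
  have memD: "monomial_degree m \<in> D" if "Poly_Mapping.keys m \<subseteq> {1..n}" "m \<notin> J" for m
  proof -
    have "(monomial m :: 'k mpoly) \<in> carrier (polynomial_ring n)"
      using that(1) by (simp add: monomial_carrier_iff)
    moreover have "(monomial m :: 'k mpoly) \<notin> I" using that(2) unfolding monomial_mem_I by blast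
    moreover have "homogeneous (monomial_degree m) (monomial m :: 'k mpoly)"
      by (simp add: homogeneous_def)
    ultimately show ?thesis unfolding D_iff by (intro bexI[of _ "monomial m"] conjI)
  qed
  obtain m where m: "Poly_Mapping.keys m \<subseteq> {1..n}" "m \<notin> J"
    "monomial_degree m = (\<Sum>i\<in>M. a i - 1)"
    "\<forall>i\<in>{1..n}. m + Poly_Mapping.single i 1 \<in> J"
    using socle_monomial[OF M E a, folded J_def] by (elim exE conjE)
  obtain m' where m': "Poly_Mapping.keys m' \<subseteq> {1..n}" "m' \<notin> J"
    "monomial_degree m' = (\<Sum>i\<in>M'. a i - 1)"
    using socle_monomial[OF M' E a, folded J_def] by (elim exE conjE)
  have D'in: "monomial_degree m' \<in> D" using memD[OF m'(1,2)] .
  have top: "top_degree n I (Max D)"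
    unfolding top_degree_def
  proof (intro conjI allI impI)
    have "Max D \<in> D" using Max_in[OF finD] D'in by blast
    then show "graded_component n I (Max D) \<noteq> {\<zero>\<^bsub>quotient_algebra n I\<^esub>}"
      unfolding D_def by (rule CollectD)
    fix d assume "Max D < d"
    then have "d \<notin> D" using Max_ge[OF finD, of d] by auto
    then show "graded_component n I d = {\<zero>\<^bsub>quotient_algebra n I\<^esub>}" by (simp add: D_def)
  qed
  have lt: "monomial_degree m < Max D"
    using Max_ge[OF finD D'in] less m(3) m'(3) by linarith
  have carr: "(monomial m :: 'k mpoly) \<in> carrier (polynomial_ring n)"
    using m(1) by (simp add: monomial_carrier_iff)
  have nz: "residue n I (monomial m) \<noteq> \<zero>\<^bsub>quotient_algebra n I\<^esub>"
    unfolding residue_eq_zero_iff[OF idI carr] monomial_mem_I using m(2) by blast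
  have gc: "residue n I (monomial m) \<in> graded_component n I (monomial_degree m)"
    unfolding graded_component_def using carr by (intro imageI) (simp add: homogeneous_def)
  have soc: "residue n I (monomial m) \<in> socle n I"
    unfolding socle_def
  proof (intro CollectI conjI ballI)
    show "residue n I (monomial m) \<in> carrier (quotient_algebra n I)"
      using ideal.rcos_ring_hom[OF idI] carr by (rule ring_hom_closed)
    fix i assume i: "i \<in> {1..n}"
    have v: "(var i :: 'k mpoly) \<in> carrier (polynomial_ring n)"
      using i by (simp add: var_def monomial_carrier_iff)
    have prod: "(monomial m :: 'k mpoly) \<otimes>\<^bsub>polynomial_ring n\<^esub> var i = monomial (m + Poly_Mapping.single i 1)"
      by (simp add: polynomial_ring_def var_def mult_single)
    have "Poly_Mapping.keys (m + Poly_Mapping.single i 1) \<subseteq> {1..n}"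
      by (rule order.trans[OF keys_add]) (use m(1) i in auto)
    then have "(monomial (m + Poly_Mapping.single i 1) :: 'k mpoly) \<in> I"
      using m(4) i unfolding monomial_mem_I by blast
    moreover from this have "(monomial (m + Poly_Mapping.single i 1) :: 'k mpoly) \<in> carrier (polynomial_ring n)"
      unfolding mem_I by (rule conjunct1)
    ultimately have "residue n I (monomial m \<otimes>\<^bsub>polynomial_ring n\<^esub> var i) = \<zero>\<^bsub>quotient_algebra n I\<^esub>"
      unfolding prod by (simp add: residue_eq_zero_iff[OF idI])
    then show "residue n I (monomial m) \<otimes>\<^bsub>quotient_algebra n I\<^esub> residue n I (var i) = \<zero>\<^bsub>quotient_algebra n I\<^esub>"
      using ring_hom_mult[OF ideal.rcos_ring_hom[OF idI] carr v] by simp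
  qed
  show ?thesis
  proof
    assume "level n (edge_ideal n E <+>\<^bsub>polynomial_ring n\<^esub> power_ideal n a :: 'k mpoly set)"
    then have "level n I" unfolding I_def .
    then have "ring.dimension (quotient_algebra n I) 0 (scalars n I)
        (socle n I \<inter> graded_component n I (monomial_degree m))"
      using top lt unfolding level_def by blast
    \<comment> \<open>Dimension 0 can arise only from the base case of the inductive definition,
      which is the zero space.\<close>
    then have "socle n I \<inter> graded_component n I (monomial_degree m) = {\<zero>\<^bsub>quotient_algebra n I\<^esub>}"
      by (cases rule: ring.dimension.cases[OF ideal.quotient_is_ring[OF idI]]) auto
    then show False using nz gc soc by blast
  qed
qed

text \<open>The remaining set \<open>c ` {5..<K}\<close> is completed to a maximal independent set by the path positions
  \<open>{0, 2, 4}\<close>, \<open>{1, 3}\<close>, \<open>{0, 3}\<close> and \<open>{1, 4}\<close>; equal weights would force weight 0 at position 2.\<close>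

lemma not_level_if_path:
  fixes E :: "nat set set" and a :: "nat \<Rightarrow> nat" and c :: "nat \<Rightarrow> nat"
  assumes E: "E \<subseteq> vertex_pairs n" and a: "\<forall>i\<in>{1..n}. 2 \<le> a i"
    and inj: "inj_on c {..<K}" and cn: "c ` {..<K} \<subseteq> {1..n}" and K: "5 \<le> K"
    and path: "\<And>i j. i < j \<Longrightarrow> j < K \<Longrightarrow> {c i, c j} \<in> E \<longleftrightarrow> j = Suc i \<and> j < 5"
    and dom: "\<And>v. v \<in> {1..n} - c ` {..<K} \<Longrightarrow> \<exists>i\<in>{5..<K}. {c i, v} \<in> E"
  shows "\<not> level n (edge_ideal n E <+>\<^bsub>polynomial_ring n\<^esub> power_ideal n a :: ('k::field) mpoly set)"
proof
  assume level: "level n (edge_ideal n E <+>\<^bsub>polynomial_ring n\<^esub> power_ideal n a :: 'k mpoly set)"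
  define S where "S = {5..<K}"
  have path': "{c i, c j} \<in> E \<longleftrightarrow> (j = Suc i \<and> j < 5) \<or> (i = Suc j \<and> i < 5)"
    if "i < K" "j < K" for i j
  proof -
    consider "i < j" | "i = j" | "j < i" by linarith
    then show ?thesis
    proof cases
      case 2
      then have "{c i, c j} \<notin> E" using E vertex_pairs_doubleton[of "c i" "c j" n] by blast
      then show ?thesis using 2 by simp
    qed (use path[of i j] path[of j i] that in \<open>auto simp: insert_commute\<close>)
  qed
  \<comment> \<open>The condition makes \<open>T\<close> a maximal independent set of the path on
    positions 0 to 4: a position belongs to \<open>T\<close> iff it has no neighbour in
    \<open>T\<close>. Position 0 is split off because \<open>0 - 1 = 0\<close>; for position 4 the
    absent neighbour 5 is outside \<open>T\<close> by the first condition.\<close>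
  have max: "maximal_independent n E (c ` (T \<union> S))"
    if T: "T \<subseteq> {..<5}" "\<And>i. i < 5 \<Longrightarrow> i \<in> T \<longleftrightarrow> Suc i \<notin> T \<and> (i = 0 \<or> i - 1 \<notin> T)" for T
    unfolding maximal_independent_def
  proof (intro conjI ballI)
    have TK: "T \<union> S \<subseteq> {..<K}" using T(1) K by (auto simp: S_def)
    then show "c ` (T \<union> S) \<subseteq> {1..n}" using cn by blast
    show "{x, y} \<notin> E" if xy: "x \<in> c ` (T \<union> S)" "y \<in> c ` (T \<union> S)" for x y
    proof
      assume "{x, y} \<in> E"
      obtain i j where ij: "x = c i" "y = c j" "i \<in> T \<union> S" "j \<in> T \<union> S" using xy by blast
      then have "(j = Suc i \<and> j < 5) \<or> (i = Suc j \<and> i < 5)"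
        using path'[of i j] TK \<open>{x, y} \<in> E\<close> by blast
      then show False
        using ij(3,4) T(2)[of i] T(2)[of j] by (auto simp: S_def)
    qed
    fix v assume v: "v \<in> {1..n} - c ` (T \<union> S)"
    show "\<exists>x\<in>c ` (T \<union> S). {x, v} \<in> E"
    proof (cases "v \<in> c ` {..<K}")
      case True
      then obtain i where i: "i < K" "v = c i" by blast
      then have "i < 5" "i \<notin> T" using v by (auto simp: S_def)
      then consider "Suc i \<in> T" | "0 < i" "i - 1 \<in> T" using T(2)[of i] by auto
      then show ?thesis
      proof cases
        case 1
        then have "Suc i < 5" using T(1) by auto
        then have "{c (Suc i), v} \<in> E" using path'[of "Suc i" i] i K by auto
        then show ?thesis using 1 by blast
      next
        case 2
        then have "{c (i - 1), v} \<in> E" using path'[of "i - 1" i] i \<open>i < 5\<close> by auto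
        then show ?thesis using 2 by blast
      qed
    next
      case False
      then show ?thesis using dom[of v] v by (auto simp: S_def)
    qed
  qed
  define w where "w i = a (c i) - 1" for i
  have weight: "(\<Sum>x\<in>c ` (T \<union> S). a x - 1) = sum w T + sum w S" if "T \<subseteq> {..<5}" for T
  proof -
    have "inj_on c (T \<union> S)"
      using that K by (intro inj_on_subset[OF inj]) (auto simp: S_def)
    then have "(\<Sum>x\<in>c ` (T \<union> S). a x - 1) = sum w (T \<union> S)"
      by (simp add: sum.reindex w_def)
    also have "\<dots> = sum w T + sum w S"
      using that finite_subset[OF that] by (intro sum.union_disjoint) (auto simp: S_def)
    finally show ?thesis .
  qed
  have le: "sum w T' \<le> sum w T"
    if "T \<subseteq> {..<5}" "\<And>i. i < 5 \<Longrightarrow> i \<in> T \<longleftrightarrow> Suc i \<notin> T \<and> (i = 0 \<or> i - 1 \<notin> T)"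
      "T' \<subseteq> {..<5}" "\<And>i. i < 5 \<Longrightarrow> i \<in> T' \<longleftrightarrow> Suc i \<notin> T' \<and> (i = 0 \<or> i - 1 \<notin> T')" for T T'
  proof (rule ccontr)
    assume "\<not> ?thesis"
    then have "(\<Sum>x\<in>c ` (T \<union> S). a x - 1) < (\<Sum>x\<in>c ` (T' \<union> S). a x - 1)"
      unfolding weight[OF that(1)] weight[OF that(3)] by simp
    from not_level_edge_power_ideal[OF E a max[OF that(1,2)] max[OF that(3,4)] this] level
    show False by blast
  qed
  have less5: "i < 5 \<longleftrightarrow> i = 0 \<or> i = 1 \<or> i = 2 \<or> i = 3 \<or> i = 4" for i :: nat by auto
  have "sum w {0, 2, 4} = sum w {1, 3}" "sum w {0, 3} = sum w {1, 3}" "sum w {1, 4} = sum w {1, 3}"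
    by (rule antisym; rule le; auto simp: less5)+
  \<comment> \<open>Cancelling gives \<open>w 0 = w 1\<close> and \<open>w 3 = w 4\<close>, so
    \<open>{0, 2, 4}\<close> outweighs \<open>{1, 3}\<close> by exactly \<open>w 2\<close>.\<close>
  then have "w 2 = 0" by simp
  moreover have "c 2 \<in> {1..n}" using cn K by (intro subsetD[OF cn] imageI) simp
  ultimately show False using bspec[OF a, of "c 2"] by (simp add: w_def)
qed


section \<open>Second moment\<close>

lemma finite_vertex_pairs: "finite (vertex_pairs n)"
proof (rule finite_subset)
  show "vertex_pairs n \<subseteq> Pow {1..n}" by (auto simp: vertex_pairs_def)
qed simp

lemma doubleton_in_vertex_pairs:
  assumes "i \<in> {1..n}" "j \<in> {1..n}" "i \<noteq> j"
  shows "{i, j} \<in> vertex_pairs n"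
proof (cases "i < j")
  case True
  then show ?thesis using assms by (auto simp: vertex_pairs_def)
next
  case False
  then have "{i, j} = {j, i} \<and> 1 \<le> j \<and> j < i \<and> i \<le> n" using assms by auto
  then show ?thesis unfolding vertex_pairs_def by blast
qed

text \<open>The event fixes some of the independent coordinates and leaves the others free, so its
  preimage is a product set.\<close>

lemma prob_random_graph:
  assumes p: "0 \<le> p" "p \<le> 1" and A: "A \<subseteq> vertex_pairs n" and B: "B \<subseteq> vertex_pairs n"
    and disj: "A \<inter> B = {}"
  shows "measure_pmf.prob (random_graph n p) {E. A \<subseteq> E \<and> B \<inter> E = {}}
    = p ^ card A * (1 - p) ^ card B"
proof -
  let ?V = "vertex_pairs n"
  let ?S = "\<lambda>e. if e \<in> A then {True} else if e \<in> B then {False} else UNIV"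
  have "measure_pmf.prob (random_graph n p) {E. A \<subseteq> E \<and> B \<inter> E = {}}
      = measure_pmf.prob (Pi_pmf ?V False (\<lambda>_. bernoulli_pmf p))
          ((\<lambda>\<omega>. {e \<in> ?V. \<omega> e}) -` {E. A \<subseteq> E \<and> B \<inter> E = {}})"
    by (simp add: random_graph_def)
  also have "(\<lambda>\<omega>. {e \<in> ?V. \<omega> e}) -` {E. A \<subseteq> E \<and> B \<inter> E = {}} = Pi ?V ?S"
    using A B disj by (auto simp: Pi_iff disjoint_iff subset_iff split: if_splits) blast
  also have "measure_pmf.prob (Pi_pmf ?V False (\<lambda>_. bernoulli_pmf p)) (Pi ?V ?S)
      = (\<Prod>e\<in>?V. measure_pmf.prob (bernoulli_pmf p) (?S e))"
    by (rule measure_Pi_pmf_Pi[OF finite_vertex_pairs])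
  also have "\<dots> = (\<Prod>e\<in>?V. (if e \<in> A then p else 1) * (if e \<in> B then 1 - p else 1))"
    using p disj by (intro prod.cong) (auto simp: measure_pmf_single)
  also have "\<dots> = p ^ card A * (1 - p) ^ card B"
    using A B finite_vertex_pairs[of n]
    by (simp add: prod.distrib Int_absorb1 flip: prod.inter_restrict)
  finally show ?thesis .
qed

text \<open>Let X and Y count the events \<open>D f\<close> and \<open>P f\<close> that occur.
  Pointwise \<open>2 * s * X - s^2 * Y^2\<close> is at most the indicator of the union: if some
  \<open>D f\<close> occurs, use X \<le> Y and \<open>(1 - s * Y)^2\<close> \<ge> 0; otherwise X =
  0. Joint probabilities are thus taken only of the simpler events \<open>P f\<close>.\<close>

lemma second_moment_bound:
  fixes M :: "'a pmf" and P D :: "'b \<Rightarrow> 'a set"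
  assumes fin: "finite F" and DP: "\<And>f. f \<in> F \<Longrightarrow> D f \<subseteq> P f" and s: "0 \<le> s"
  shows "2 * s * (\<Sum>f\<in>F. measure_pmf.prob M (D f))
      - s\<^sup>2 * (\<Sum>f\<in>F. \<Sum>g\<in>F. measure_pmf.prob M (P f \<inter> P g))
    \<le> measure_pmf.prob M (\<Union>f\<in>F. D f)"
proof -
  let ?X = "\<lambda>\<omega>. \<Sum>f\<in>F. indicat_real (D f) \<omega>"
  let ?Y2 = "\<lambda>\<omega>. \<Sum>f\<in>F. \<Sum>g\<in>F. indicat_real (P f \<inter> P g) \<omega>"
  have int: "integrable (measure_pmf M) (indicat_real S)" for S
    by (rule integrable_real_indicator) (auto simp: less_top[symmetric])
  have intX: "integrable (measure_pmf M) ?X" and intY: "integrable (measure_pmf M) ?Y2"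
    by (intro Bochner_Integration.integrable_sum int)+
  have "2 * s * (\<Sum>f\<in>F. measure_pmf.prob M (D f))
      - s\<^sup>2 * (\<Sum>f\<in>F. \<Sum>g\<in>F. measure_pmf.prob M (P f \<inter> P g))
    = measure_pmf.expectation M (\<lambda>\<omega>. 2 * s * ?X \<omega> - s\<^sup>2 * ?Y2 \<omega>)"
    using intX intY int by (simp add: Bochner_Integration.integral_sum)
  also have "\<dots> \<le> measure_pmf.expectation M (indicat_real (\<Union>f\<in>F. D f))"
  proof (rule integral_mono)
    fix \<omega>
    define Y where "Y = (\<Sum>f\<in>F. indicat_real (P f) \<omega>)"
    have Y2: "?Y2 \<omega> = Y\<^sup>2"
      by (simp add: Y_def power2_eq_square sum_product indicator_inter_arith)
    show "2 * s * ?X \<omega> - s\<^sup>2 * ?Y2 \<omega> \<le> indicat_real (\<Union>f\<in>F. D f) \<omega>"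
    proof (cases "\<omega> \<in> (\<Union>f\<in>F. D f)")
      case True
      have "?X \<omega> \<le> Y"
        unfolding Y_def using DP by (intro sum_mono) (auto simp: indicator_def)
      then have "2 * s * ?X \<omega> \<le> 2 * s * Y" using s by (intro mult_left_mono) auto
      moreover have "0 \<le> (1 - s * Y)\<^sup>2" by simp
      ultimately show ?thesis
        using True unfolding Y2 by (simp add: power2_eq_square algebra_simps)
    next
      case False
      then have "?X \<omega> = 0" by (intro sum.neutral) auto
      then show ?thesis using False unfolding Y2 by (simp add: indicator_def)
    qed
  qed (use intX intY int in auto)
  also have "\<dots> = measure_pmf.prob M (\<Union>f\<in>F. D f)" by simp
  finally show ?thesis .
qed


section \<open>Transversal paths\<close>

text \<open>The vertices \<open>1, \<dots>, K m\<close> are split into \<open>K\<close> blocks of length \<open>m\<close>, and \<open>f\<close> picks one vertex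
  from each block; two such choices overlap exactly where they agree, so that the sum over all
  pairs factors over the blocks.\<close>

definition block_vertex :: "nat \<Rightarrow> (nat \<Rightarrow> nat) \<Rightarrow> nat \<Rightarrow> nat" where
  "block_vertex m f i = i * m + f i + 1"

definition path_edges :: "nat \<Rightarrow> (nat \<Rightarrow> nat) \<Rightarrow> nat set set" where
  "path_edges m f = (\<lambda>i. {block_vertex m f i, block_vertex m f (Suc i)}) ` {..<4}"

text \<open>Besides the remaining pairs of path positions this contains all pairs meeting a position
  from 5 on: the path is induced, the other positions are independent and have no edge to
  it.\<close>

definition path_nonedges :: "nat \<Rightarrow> nat \<Rightarrow> (nat \<Rightarrow> nat) \<Rightarrow> nat set set" where
  "path_nonedges K m f =
     {e. e \<subseteq> block_vertex m f ` {..<K} \<and> card e = 2} - path_edges m f"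

definition path_event :: "nat \<Rightarrow> nat \<Rightarrow> (nat \<Rightarrow> nat) \<Rightarrow> nat set set set" where
  "path_event K m f = {E. path_edges m f \<subseteq> E \<and> path_nonedges K m f \<inter> E = {}}"

text \<open>Domination is asked of the positions from 5 on, because these belong to all four
  completed independent sets, whereas each path position is missing from some of them.\<close>

definition dominating_path_event :: "nat \<Rightarrow> nat \<Rightarrow> nat \<Rightarrow> (nat \<Rightarrow> nat) \<Rightarrow> nat set set set" where
  "dominating_path_event n K m f = path_event K m f \<inter>
     {E. \<forall>v\<in>{1..n} - block_vertex m f ` {..<K}. \<exists>i\<in>{5..<K}. {block_vertex m f i, v} \<in> E}"

text \<open>Division by \<open>m\<close> recovers the block, so vertices of different blocks never
  coincide.\<close>

lemma block_vertex_eq_iff: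
  assumes "f i < m" "g j < m"
  shows "block_vertex m f i = block_vertex m g j \<longleftrightarrow> i = j \<and> f i = g j"
proof
  assume "block_vertex m f i = block_vertex m g j"
  then have eq: "i * m + f i = j * m + g j" by (simp add: block_vertex_def)
  have "(i * m + f i) div m = i" "(j * m + g j) div m = j" using assms by auto
  then show "i = j \<and> f i = g j" using eq by auto
qed (auto simp: block_vertex_def)

lemma inj_on_block_vertex:
  assumes "f \<in> {..<K} \<rightarrow>\<^sub>E {..<m}"
  shows "inj_on (block_vertex m f) {..<K}"
  using assms by (intro inj_onI) (auto simp: block_vertex_eq_iff PiE_iff)

lemma block_vertex_range:
  assumes "f \<in> {..<K} \<rightarrow>\<^sub>E {..<m}" "K * m \<le> n"
  shows "block_vertex m f ` {..<K} \<subseteq> {1..n}"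
proof safe
  fix i assume i: "i < K"
  then have "f i < m" using assms(1) by auto
  then have "block_vertex m f i \<le> Suc i * m" by (simp add: block_vertex_def)
  also have "\<dots> \<le> K * m" using i by (intro mult_right_mono) auto
  finally show "block_vertex m f i \<in> {1..n}" using assms(2) by (simp add: block_vertex_def)
qed

lemma card_path_edges:
  assumes f: "f \<in> {..<K} \<rightarrow>\<^sub>E {..<m}" and K: "5 \<le> K"
  shows "card (path_edges m f) = 4"
proof -
  have "inj_on (\<lambda>i. {block_vertex m f i, block_vertex m f (Suc i)}) {..<4}"
  proof (rule inj_onI)
    fix i j :: nat
    assume "i \<in> {..<4}" "j \<in> {..<4}"
      and "{block_vertex m f i, block_vertex m f (Suc i)} = {block_vertex m f j, block_vertex m f (Suc j)}"
    then show "i = j"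
      using K inj_on_eq_iff[OF inj_on_block_vertex[OF f]] by (auto simp: doubleton_eq_iff)
  qed
  then show ?thesis by (simp add: path_edges_def card_image)
qed

lemma path_edges_subset:
  assumes f: "f \<in> {..<K} \<rightarrow>\<^sub>E {..<m}" and K: "5 \<le> K"
  shows "path_edges m f \<subseteq> {e. e \<subseteq> block_vertex m f ` {..<K} \<and> card e = 2}"
  using K inj_on_eq_iff[OF inj_on_block_vertex[OF f]] by (auto simp: path_edges_def card_insert_if)

lemma card_path_nonedges:
  assumes f: "f \<in> {..<K} \<rightarrow>\<^sub>E {..<m}" and K: "5 \<le> K"
  shows "card (path_nonedges K m f) = (K choose 2) - 4"
  unfolding path_nonedges_def
  using card_image[OF inj_on_block_vertex[OF f]] path_edges_subset[OF f K] card_path_edges[OF f K]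
  by (subst card_Diff_subset) (auto simp: n_subsets path_edges_def)

lemma two_subset_vertex_pairs:
  assumes "T \<subseteq> {1..n}"
  shows "{e. e \<subseteq> T \<and> card e = 2} \<subseteq> vertex_pairs n"
proof safe
  fix e assume "e \<subseteq> T" "card e = 2"
  then obtain i j where "e = {i, j}" "i \<noteq> j" by (auto simp: card_2_iff)
  then show "e \<in> vertex_pairs n"
    using \<open>e \<subseteq> T\<close> assms by (auto intro!: doubleton_in_vertex_pairs)
qed

lemma path_pairs_in_vertex_pairs:
  assumes f: "f \<in> {..<K} \<rightarrow>\<^sub>E {..<m}" and K: "5 \<le> K" and n: "K * m \<le> n"
  shows "path_edges m f \<subseteq> vertex_pairs n" "path_nonedges K m f \<subseteq> vertex_pairs n"
  using two_subset_vertex_pairs[OF block_vertex_range[OF f n]] path_edges_subset[OF f K]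
  unfolding path_nonedges_def by blast+

section \<open>Probabilities of the path events\<close>

lemma prob_path_event:
  assumes p: "0 \<le> p" "p \<le> 1" and f: "f \<in> {..<K} \<rightarrow>\<^sub>E {..<m}" and K: "5 \<le> K" and n: "K * m \<le> n"
  shows "measure_pmf.prob (random_graph n p) (path_event K m f)
    = p ^ 4 * (1 - p) ^ ((K choose 2) - 4)"
  using prob_random_graph[OF p path_pairs_in_vertex_pairs[OF f K n]] card_path_edges[OF f K]
    card_path_nonedges[OF f K]
  by (simp add: path_event_def path_nonedges_def)

text \<open>A union bound over the outside vertices. The \<open>K - 5\<close> pairs joining such a
  vertex to the independent positions are disjoint from those prescribed by
  \<open>path_event\<close>, so the absence of all of them contributes an independent factor
  \<open>(1 - p) ^ (K - 5)\<close>.\<close>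

lemma prob_dominating_path_event:
  assumes p: "0 \<le> p" "p \<le> 1" and f: "f \<in> {..<K} \<rightarrow>\<^sub>E {..<m}" and K: "5 \<le> K" and n: "K * m \<le> n"
  shows "measure_pmf.prob (random_graph n p) (dominating_path_event n K m f)
    \<ge> p ^ 4 * (1 - p) ^ ((K choose 2) - 4) * (1 - n * (1 - p) ^ (K - 5))"
proof -
  let ?M = "random_graph n p"
  let ?\<pi> = "p ^ 4 * (1 - p) ^ ((K choose 2) - 4)"
  let ?c = "block_vertex m f"
  define V where "V = {1..n} - ?c ` {..<K}"
  define N where "N v = (\<lambda>i. {?c i, v}) ` {5..<K}" for v
  define Z where "Z v = path_event K m f \<inter> {E. N v \<inter> E = {}}" for v
  have rng: "?c ` {..<K} \<subseteq> {1..n}" by (rule block_vertex_range[OF f n])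
  have inj: "inj_on ?c {..<K}" by (rule inj_on_block_vertex[OF f])
  have prob_Z: "measure_pmf.prob ?M (Z v) = ?\<pi> * (1 - p) ^ (K - 5)" if v: "v \<in> V" for v
  proof -
    have v': "v \<in> {1..n}" "v \<notin> ?c ` {..<K}" using v by (auto simp: V_def)
    have sub: "e \<subseteq> ?c ` {..<K}" if "e \<in> path_edges m f \<union> path_nonedges K m f" for e
      using that path_edges_subset[OF f K] by (auto simp: path_nonedges_def)
    have Nout: "e \<notin> path_edges m f \<union> path_nonedges K m f" if "e \<in> N v" for e
      using sub[of e] v'(2) that by (auto simp: N_def)
    have "inj_on (\<lambda>i. {?c i, v}) {5..<K}"
    proof (rule inj_onI)
      fix i j assume ij: "i \<in> {5..<K}" "j \<in> {5..<K}" "{?c i, v} = {?c j, v}"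
      then have "?c i = ?c j" using v'(2) by (auto simp: doubleton_eq_iff)
      then show "i = j" using ij inj_onD[OF inj] by auto
    qed
    then have cardN: "card (N v) = K - 5" by (simp add: N_def card_image)
    have NV: "N v \<subseteq> vertex_pairs n"
    proof
      fix e assume "e \<in> N v"
      then obtain i where i: "e = {?c i, v}" "i < K" by (auto simp: N_def)
      then have "?c i \<in> {1..n}" "?c i \<noteq> v" using rng v'(2) by auto
      then show "e \<in> vertex_pairs n" using i(1) v'(1) doubleton_in_vertex_pairs by blast
    qed
    have card: "card (path_nonedges K m f \<union> N v) = ((K choose 2) - 4) + (K - 5)"
    proof (subst card_Un_disjoint)
      show "finite (path_nonedges K m f)" "finite (N v)"
        using path_pairs_in_vertex_pairs[OF f K n] NV finite_vertex_pairs finite_subset by blast+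
      show "path_nonedges K m f \<inter> N v = {}" using Nout by blast
    qed (simp add: card_path_nonedges[OF f K] cardN)
    have "Z v = {E. path_edges m f \<subseteq> E \<and> (path_nonedges K m f \<union> N v) \<inter> E = {}}"
      by (auto simp: Z_def path_event_def)
    moreover have "path_edges m f \<inter> (path_nonedges K m f \<union> N v) = {}"
      using Nout by (auto simp: path_nonedges_def)
    ultimately show ?thesis
      using prob_random_graph[OF p path_pairs_in_vertex_pairs(1)[OF f K n],
          of "path_nonedges K m f \<union> N v"] path_pairs_in_vertex_pairs(2)[OF f K n] NV
      by (simp add: card card_path_edges[OF f K] power_add)
  qed
  have finV: "finite V" by (simp add: V_def)
  have cover: "path_event K m f \<subseteq> dominating_path_event n K m f \<union> (\<Union>v\<in>V. Z v)"
    by (auto simp: dominating_path_event_def Z_def V_def N_def)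
  have "?\<pi> = measure_pmf.prob ?M (path_event K m f)"
    by (rule prob_path_event[OF p f K n, symmetric])
  also have "\<dots> \<le> measure_pmf.prob ?M (dominating_path_event n K m f \<union> (\<Union>v\<in>V. Z v))"
    using cover by (intro measure_pmf.finite_measure_mono) auto
  also have "\<dots> \<le> measure_pmf.prob ?M (dominating_path_event n K m f)
      + measure_pmf.prob ?M (\<Union>v\<in>V. Z v)"
    by (intro measure_Un_le) auto
  also have "measure_pmf.prob ?M (\<Union>v\<in>V. Z v) \<le> (\<Sum>v\<in>V. measure_pmf.prob ?M (Z v))"
    using finV by (intro measure_pmf.finite_measure_subadditive_finite) auto
  also have "\<dots> = card V * (?\<pi> * (1 - p) ^ (K - 5))"
    by (simp add: prob_Z)
  also have "\<dots> \<le> n * (?\<pi> * (1 - p) ^ (K - 5))"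
    using card_mono[of "{1..n}" V] p by (intro mult_right_mono) (auto simp: V_def)
  finally show ?thesis by (simp add: algebra_simps)
qed

text \<open>Pairs prescribed by both events lie among the \<open>l\<close> common vertices, and each
  shared non-edge saves a factor \<open>1 - p\<close>. As \<open>l\<close> is at most
  \<open>2 * h\<close>, \<open>l choose 2\<close> is at most \<open>l * h\<close>; this linear
  exponent turns the correction into the \<open>l\<close>-th power of a fixed base, which can be
  summed block by block. Shared path edges cost at most \<open>1 / p ^ 4\<close>. The bound is
  shaped to give the correction factor 1 at \<open>l = 0\<close>, where the events are
  independent.\<close>

lemma prob_two_paths:
  fixes p :: real
  assumes p: "0 < p" "p < 1" and f: "f \<in> {..<K} \<rightarrow>\<^sub>E {..<m}" and g: "g \<in> {..<K} \<rightarrow>\<^sub>E {..<m}"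
    and K: "K = 2 * h" "3 \<le> h" and n: "K * m \<le> n"
  defines "l \<equiv> card {i \<in> {..<K}. f i = g i}"
  shows "measure_pmf.prob (random_graph n p) (path_event K m f \<inter> path_event K m g)
    \<le> (p ^ 4 * (1 - p) ^ ((K choose 2) - 4))\<^sup>2 * (1 + (((1 / (1 - p)) ^ h) ^ l - 1) / p ^ 5)"
proof -
  let ?M = "random_graph n p"
  define q where "q = 1 - p"
  define N where "N = (K choose 2) - 4"
  define L where "L = {i \<in> {..<K}. f i = g i}"
  define x where "x = ((1 / q) ^ h) ^ l"
  have q: "0 < q" "q < 1" using p by (auto simp: q_def)
  have p': "0 \<le> p" "p \<le> 1" using p by auto
  have K5: "5 \<le> K" using K by simp
  note sub = path_pairs_in_vertex_pairs[OF f K5 n] path_pairs_in_vertex_pairs[OF g K5 n]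
  note fin = sub[THEN finite_subset, OF finite_vertex_pairs]
  have inter: "block_vertex m f ` {..<K} \<inter> block_vertex m g ` {..<K} = block_vertex m f ` L"
  proof (intro equalityI subsetI)
    fix v assume "v \<in> block_vertex m f ` {..<K} \<inter> block_vertex m g ` {..<K}"
    then obtain i j where ij: "i < K" "j < K" "v = block_vertex m f i" "v = block_vertex m g j"
      by blast
    then have "i = j \<and> f i = g j"
      using f g by (subst block_vertex_eq_iff[of f i m g j, symmetric]) auto
    then show "v \<in> block_vertex m f ` L"
      using ij by (auto simp: L_def)
  next
    fix v assume "v \<in> block_vertex m f ` L"
    then obtain i where i: "i < K" "f i = g i" "v = block_vertex m f i" by (auto simp: L_def)
    then have "v = block_vertex m g i" by (simp add: block_vertex_def)
    then show "v \<in> block_vertex m f ` {..<K} \<inter> block_vertex m g ` {..<K}" using i by blast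
  qed
  have lK: "l \<le> K" unfolding l_def using card_mono[of "{..<K}" "{i \<in> {..<K}. f i = g i}"] by auto
  have cardL: "card (block_vertex m f ` L) = l"
    unfolding l_def L_def by (intro card_image inj_on_subset[OF inj_on_block_vertex[OF f]]) auto
  have finL: "finite (block_vertex m f ` L)" by (simp add: L_def)
  have common: "(path_edges m f \<union> path_nonedges K m f) \<inter> (path_edges m g \<union> path_nonedges K m g)
      \<subseteq> {e. e \<subseteq> block_vertex m f ` L \<and> card e = 2}"
    using path_edges_subset[OF f K5] path_edges_subset[OF g K5] unfolding inter[symmetric] path_nonedges_def
    by blast
  have prob_le: "measure_pmf.prob ?M (path_event K m f \<inter> path_event K m g)
      \<le> p ^ card (path_edges m f \<union> path_edges m g)
        * q ^ card (path_nonedges K m f \<union> path_nonedges K m g)"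
  \<comment> \<open>A pair demanded by one event and forbidden by the other makes the intersection
    empty.\<close>
  proof (cases "(path_edges m f \<union> path_edges m g) \<inter> (path_nonedges K m f \<union> path_nonedges K m g) = {}")
    case True
    have "path_event K m f \<inter> path_event K m g = {E. path_edges m f \<union> path_edges m g \<subseteq> E
        \<and> (path_nonedges K m f \<union> path_nonedges K m g) \<inter> E = {}}"
      by (auto simp: path_event_def)
    then show ?thesis
      using prob_random_graph[OF p' _ _ True, of n] sub by (simp add: q_def)
  next
    case False
    then have "path_event K m f \<inter> path_event K m g = {}"
      by (auto simp: path_event_def)
    then show ?thesis using p q by simp
  qed
  have cardN: "card (path_nonedges K m f) = N" "card (path_nonedges K m g) = N"
    using card_path_nonedges[OF f K5] card_path_nonedges[OF g K5] by (auto simp: N_def)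
  show ?thesis
  proof (cases "l = 0")
    case True
    then have "block_vertex m f ` L = {}" using cardL finL by simp
    then have "(path_edges m f \<union> path_nonedges K m f) \<inter> (path_edges m g \<union> path_nonedges K m g) = {}"
      using common by (auto simp: subset_iff)
    then have "card (path_edges m f \<union> path_edges m g) = 8"
      "card (path_nonedges K m f \<union> path_nonedges K m g) = N + N"
      using fin cardN card_path_edges[OF f K5] card_path_edges[OF g K5]
      by (subst card_Un_disjoint; auto)+
    then show ?thesis
      using prob_le True by (simp add: q_def N_def power_mult_distrib mult_2_right flip: power_mult)
  next
    case False
    have "card (path_nonedges K m f \<inter> path_nonedges K m g) \<le> card {e. e \<subseteq> block_vertex m f ` L \<and> card e = 2}"
      using common finL by (intro card_mono) (auto intro: finite_subset[OF _ finite_Pow_iff[THEN iffD2]])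
    also have "\<dots> = l choose 2" using n_subsets[OF finL] cardL by simp
    also have "\<dots> \<le> l * h"
    proof -
      have "l * (l - 1) \<le> l * (2 * h)" using lK K(1) by (intro mult_left_mono) auto
      then have "l * (l - 1) div 2 \<le> 2 * (l * h) div 2" by (intro div_le_mono) simp
      then show ?thesis by (simp add: choose_two)
    qed
    finally have capN: "card (path_nonedges K m f \<inter> path_nonedges K m g) \<le> l * h" .
    have "card (path_nonedges K m f \<union> path_nonedges K m g)
        + card (path_nonedges K m f \<inter> path_nonedges K m g) = N + N"
      using card_Un_Int[of "path_nonedges K m f" "path_nonedges K m g"] fin cardN by simp
    then have cupN: "N + N \<le> card (path_nonedges K m f \<union> path_nonedges K m g) + l * h"
      using capN by simp
    have "q ^ card (path_nonedges K m f \<union> path_nonedges K m g) * q ^ (l * h) \<le> q ^ (N + N)"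
      unfolding power_add[symmetric] using cupN q by (intro power_decreasing) auto
    then have qle: "q ^ card (path_nonedges K m f \<union> path_nonedges K m g) \<le> q ^ (N + N) * x"
      using q by (simp add: x_def power_one_over field_simps flip: power_mult)
    have "4 \<le> card (path_edges m f \<union> path_edges m g)"
      using card_mono[of "path_edges m f \<union> path_edges m g" "path_edges m f"] fin card_path_edges[OF f K5]
      by auto
    then have "p ^ card (path_edges m f \<union> path_edges m g) \<le> p ^ 4"
      using p by (intro power_decreasing) auto
    with qle have "p ^ card (path_edges m f \<union> path_edges m g)
        * q ^ card (path_nonedges K m f \<union> path_nonedges K m g) \<le> p ^ 4 * (q ^ (N + N) * x)"
      using p q by (intro mult_mono) auto
    also have "\<dots> = (p ^ 4 * q ^ N)\<^sup>2 * (x / p ^ 4)"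
      using p by (simp add: power2_eq_square power_add field_simps)
    \<comment> \<open>Since \<open>l\<close> is positive, \<open>x\<close> is at least
      \<open>1 / (1 - p)\<close>, that is, \<open>p * x\<close> is at most \<open>x - 1\<close>.
      Trading \<open>x\<close> for \<open>x - 1\<close> costs one more \<open>1 / p\<close>, hence
      the fifth power.\<close>
    also have "x / p ^ 4 \<le> 1 + (x - 1) / p ^ 5"
    proof -
      have "1 / q ^ 1 \<le> 1 / q ^ (h * l)"
        using False K(2) q by (intro divide_left_mono power_decreasing) (auto simp: Suc_le_eq)
      then have "1 \<le> q * x"
        using q by (simp add: x_def power_one_over field_simps flip: power_mult)
      then have "p * x \<le> x - 1" by (simp add: q_def algebra_simps)
      then have "p * x / p ^ 5 \<le> (x - 1) / p ^ 5" using p by (intro divide_right_mono) auto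
      moreover have "p * x / p ^ 5 = x / p ^ 4" using p by (simp add: eval_nat_numeral)
      ultimately show ?thesis by simp
    qed
    finally show ?thesis
      using prob_le p q by (simp add: q_def N_def x_def mult_left_mono)
  qed
qed

text \<open>The power is a product over the blocks, so sum and product interchange. In each block
  one value agrees with \<open>g\<close> and contributes \<beta>; the other \<open>m - 1\<close>
  values contribute 1 each.\<close>

lemma sum_agreement:
  fixes \<beta> :: real
  assumes g: "g \<in> {..<K} \<rightarrow>\<^sub>E {..<m}"
  shows "(\<Sum>f\<in>{..<K} \<rightarrow>\<^sub>E {..<m}. \<beta> ^ card {i \<in> {..<K}. f i = g i}) = (real m - 1 + \<beta>) ^ K"
proof -
  have "(\<Sum>f\<in>{..<K} \<rightarrow>\<^sub>E {..<m}. \<beta> ^ card {i \<in> {..<K}. f i = g i})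
      = (\<Sum>f\<in>{..<K} \<rightarrow>\<^sub>E {..<m}. \<Prod>i<K. if f i = g i then \<beta> else 1)"
    by (intro sum.cong refl) (simp flip: prod.inter_filter)
  also have "\<dots> = (\<Prod>i<K. \<Sum>y<m. if y = g i then \<beta> else 1)"
    by (rule prod_sum_PiE[symmetric]) auto
  also have "\<dots> = (\<Prod>i<K. real m - 1 + \<beta>)"
  proof (rule prod.cong[OF refl])
    fix i assume "i \<in> {..<K}"
    then have "g i \<in> {..<m}" using g by auto
    then have "(\<Sum>y<m. if y = g i then \<beta> else 1) = \<beta> + (\<Sum>y\<in>{..<m} - {g i}. if y = g i then \<beta> else 1)"
      by (subst sum.remove[of _ "g i"]) auto
    also have "(\<Sum>y\<in>{..<m} - {g i}. if y = g i then \<beta> else 1) = real (card ({..<m} - {g i}))"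
      by simp
    also have "\<dots> = real m - 1" using \<open>g i \<in> {..<m}\<close> by (simp add: of_nat_diff)
    finally show "(\<Sum>y<m. if y = g i then \<beta> else 1) = real m - 1 + \<beta>" by simp
  qed
  finally show ?thesis by simp
qed

text \<open>\<open>second_moment_bound\<close> with \<open>s\<close> = 1 / \<mu>, where \<mu> is the
  expected number of path events. With relative error d in the first moment and e in the second it
  yields 2 (1 - d) - (1 + e) = 1 - 2 d - e, so the domination error counts twice.\<close>

lemma prob_exists_dominating_path:
  fixes p :: real
  assumes p: "0 < p" "p < 1" and K: "K = 2 * h" "3 \<le> h" and m: "0 < m" and n: "K * m \<le> n"
  shows "measure_pmf.prob (random_graph n p)
      (\<Union>f\<in>{..<K} \<rightarrow>\<^sub>E {..<m}. dominating_path_event n K m f)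
    \<ge> 1 - 2 * n * (1 - p) ^ (K - 5) - ((1 + ((1 / (1 - p)) ^ h - 1) / m) ^ K - 1) / p ^ 5"
proof -
  let ?M = "random_graph n p"
  let ?F = "{..<K} \<rightarrow>\<^sub>E {..<m}"
  define w where "w = p ^ 4 * (1 - p) ^ ((K choose 2) - 4)"
  define \<beta> where "\<beta> = (1 / (1 - p)) ^ h"
  define \<mu> where "\<mu> = real m ^ K * w"
  have w: "0 < w" using p by (simp add: w_def)
  have \<mu>: "0 < \<mu>" using w m by (simp add: \<mu>_def)
  have p': "0 \<le> p" "p \<le> 1" using p by auto
  have K5: "5 \<le> K" using K by simp
  have cardF: "card ?F = m ^ K" by (simp add: card_PiE)
  have finF: "finite ?F" by (intro finite_PiE) auto
  have "\<mu> * (1 - n * (1 - p) ^ (K - 5)) = (\<Sum>f\<in>?F. w * (1 - n * (1 - p) ^ (K - 5)))"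
    by (simp add: \<mu>_def cardF)
  also have "\<dots> \<le> (\<Sum>f\<in>?F. measure_pmf.prob ?M (dominating_path_event n K m f))"
    using prob_dominating_path_event[OF p' _ K5 n] unfolding w_def by (intro sum_mono) auto
  finally have first: "\<mu> * (1 - n * (1 - p) ^ (K - 5))
      \<le> (\<Sum>f\<in>?F. measure_pmf.prob ?M (dominating_path_event n K m f))" .
  have "(\<Sum>f\<in>?F. \<Sum>g\<in>?F. measure_pmf.prob ?M (path_event K m f \<inter> path_event K m g))
      \<le> (\<Sum>f\<in>?F. \<Sum>g\<in>?F. w\<^sup>2 * (1 + (\<beta> ^ card {i \<in> {..<K}. g i = f i} - 1) / p ^ 5))"
    using prob_two_paths[OF p _ _ K n] unfolding w_def \<beta>_def
    by (intro sum_mono) (simp add: eq_commute)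
  also have "\<dots> = (\<Sum>f\<in>?F. w\<^sup>2 * (m ^ K + ((real m - 1 + \<beta>) ^ K - m ^ K) / p ^ 5))"
  proof (rule sum.cong[OF refl])
    fix f assume f: "f \<in> ?F"
    have "(\<Sum>g\<in>?F. w\<^sup>2 * (1 + (\<beta> ^ card {i \<in> {..<K}. g i = f i} - 1) / p ^ 5))
        = w\<^sup>2 * (card ?F + ((\<Sum>g\<in>?F. \<beta> ^ card {i \<in> {..<K}. g i = f i}) - card ?F) / p ^ 5)"
      by (simp add: sum.distrib sum_subtractf flip: sum_distrib_left sum_divide_distrib)
    then show "(\<Sum>g\<in>?F. w\<^sup>2 * (1 + (\<beta> ^ card {i \<in> {..<K}. g i = f i} - 1) / p ^ 5))
        = w\<^sup>2 * (m ^ K + ((real m - 1 + \<beta>) ^ K - m ^ K) / p ^ 5)"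
      unfolding sum_agreement[OF f] cardF by simp
  qed
  also have "\<dots> = \<mu>\<^sup>2 * (1 + ((1 + (\<beta> - 1) / m) ^ K - 1) / p ^ 5)"
  proof -
    have "real m - 1 + \<beta> = m * (1 + (\<beta> - 1) / m)" using m by (simp add: field_simps)
    then have "(real m - 1 + \<beta>) ^ K = m ^ K * (1 + (\<beta> - 1) / m) ^ K"
      by (simp add: power_mult_distrib)
    then show ?thesis
      by (simp add: cardF \<mu>_def power2_eq_square algebra_simps diff_divide_distrib)
  qed
  finally have second: "(\<Sum>f\<in>?F. \<Sum>g\<in>?F. measure_pmf.prob ?M (path_event K m f \<inter> path_event K m g))
      \<le> \<mu>\<^sup>2 * (1 + ((1 + (\<beta> - 1) / m) ^ K - 1) / p ^ 5)" .
  have "2 * (1 - n * (1 - p) ^ (K - 5)) - (1 + ((1 + (\<beta> - 1) / m) ^ K - 1) / p ^ 5)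
      = 2 * (1 / \<mu>) * (\<mu> * (1 - n * (1 - p) ^ (K - 5)))
        - (1 / \<mu>)\<^sup>2 * (\<mu>\<^sup>2 * (1 + ((1 + (\<beta> - 1) / m) ^ K - 1) / p ^ 5))"
    using \<mu> by (simp add: power2_eq_square)
  also have "\<dots> \<le> 2 * (1 / \<mu>) * (\<Sum>f\<in>?F. measure_pmf.prob ?M (dominating_path_event n K m f))
      - (1 / \<mu>)\<^sup>2 * (\<Sum>f\<in>?F. \<Sum>g\<in>?F. measure_pmf.prob ?M (path_event K m f \<inter> path_event K m g))"
    using \<mu> by (intro diff_mono mult_left_mono first second) auto
  also have "\<dots> \<le> measure_pmf.prob ?M (\<Union>f\<in>?F. dominating_path_event n K m f)"
    using \<mu> by (intro second_moment_bound finF) (auto simp: dominating_path_event_def)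
  finally show ?thesis by (simp add: \<beta>_def)
qed

section \<open>Asymptotics\<close>

text \<open>The event says nothing about \<open>a\<close>, so a graph in it fails levelness for all
  exponents together.\<close>

lemma not_level_if_dominating_path_event:
  fixes E :: "nat set set" and a :: "nat \<Rightarrow> nat"
  assumes E: "E \<subseteq> vertex_pairs n" and a: "\<forall>i\<in>{1..n}. 2 \<le> a i"
    and f: "f \<in> {..<K} \<rightarrow>\<^sub>E {..<m}" and K: "5 \<le> K" and n: "K * m \<le> n"
    and dom: "E \<in> dominating_path_event n K m f"
  shows "\<not> level n (edge_ideal n E <+>\<^bsub>polynomial_ring n\<^esub> power_ideal n a :: ('k::field) mpoly set)"
proof (rule not_level_if_path[OF E a inj_on_block_vertex[OF f] block_vertex_range[OF f n] K])
  fix i j assume ij: "i < j" "j < K"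
  let ?c = "block_vertex m f"
  note inj = inj_on_eq_iff[OF inj_on_block_vertex[OF f]]
  show "{?c i, ?c j} \<in> E \<longleftrightarrow> j = Suc i \<and> j < 5"
  proof (cases "j = Suc i \<and> j < 5")
    case True
    then have "{?c i, ?c j} \<in> path_edges m f" by (auto simp: path_edges_def)
    then show ?thesis using True dom by (auto simp: dominating_path_event_def path_event_def)
  next
    case False
    have "{?c i, ?c j} \<notin> path_edges m f"
    proof
      assume "{?c i, ?c j} \<in> path_edges m f"
      then obtain r where r: "r < 4" "{?c i, ?c j} = {?c r, ?c (Suc r)}" by (auto simp: path_edges_def)
      then show False using False ij K by (auto simp: doubleton_eq_iff inj)
    qed
    moreover have "?c i \<noteq> ?c j" using ij by (simp add: inj)
    ultimately have "{?c i, ?c j} \<in> path_nonedges K m f" using ij by (simp add: path_nonedges_def)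
    then show ?thesis using False dom by (auto simp: dominating_path_event_def path_event_def)
  qed
next
  fix v assume "v \<in> {1..n} - block_vertex m f ` {..<K}"
  then show "\<exists>i\<in>{5..<K}. {block_vertex m f i, v} \<in> E"
    using dom by (auto simp: dominating_path_event_def)
qed

lemma set_pmf_random_graph: "E \<in> set_pmf (random_graph n p) \<Longrightarrow> E \<subseteq> vertex_pairs n"
  by (auto simp: random_graph_def)

text \<open>With \<open>b = 1 / (1 - p)\<close>, sets of about \<open>1.2 log\<^sub>b n\<close> vertices are large enough to dominate
  typically, and below the threshold \<open>2 log\<^sub>b n\<close> up to which the second moment method applies.\<close>

lemma path_bound_estimate:
  fixes p :: real and n :: nat
  assumes p: "0 < p" "p < 1"
  defines "c \<equiv> - ln (1 - p)"
  defines "h \<equiv> nat \<lceil>0.6 * ln (real n) / c\<rceil>" and "\<kappa> \<equiv> 1.2 * ln (real n) / c + 2"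
  assumes n: "2 < 0.6 * ln (real n) / c" "1 < real n / \<kappa> - 1"
  shows "3 \<le> h" and "0 < n div (2 * h)"
    and "1 - 2 * (real n * exp (5 * c - 1.2 * ln (real n)))
        - (exp (\<kappa> * exp (0.6 * ln (real n) + c) / (real n / \<kappa> - 1)) - 1) / p ^ 5
      \<le> 1 - 2 * real n * (1 - p) ^ (2 * h - 5)
        - ((1 + ((1 / (1 - p)) ^ h - 1) / real (n div (2 * h))) ^ (2 * h) - 1) / p ^ 5"
proof -
  define m where "m = n div (2 * h)"
  have c: "0 < c" using p by (simp add: c_def)
  have q: "1 - p = exp (- c)" using p by (simp add: c_def)
  \<comment> \<open>Domination needs the lower bound; the overlap estimate and the block length need
    the upper one. Rounding up costs at most 1 in \<open>h\<close>, hence the 2 in \<kappa>.\<close>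
  have h_lower: "0.6 * ln (real n) / c \<le> real h" and h_upper: "real h \<le> 0.6 * ln (real n) / c + 1"
    using n(1) unfolding h_def by linarith+
  show h3: "3 \<le> h" using n(1) h_lower by linarith
  have K\<kappa>: "real (2 * h) \<le> \<kappa>" using h_upper by (simp add: \<kappa>_def)
  have "real n / \<kappa> \<le> real n / real (2 * h)"
    using K\<kappa> h3 by (intro divide_left_mono mult_pos_pos) auto
  moreover have "real n / real (2 * h) \<le> real m + 1"
  proof -
    have "n < 2 * h + m * (2 * h)" unfolding m_def using h3 by (intro dividend_less_div_times) simp
    then have "n \<le> (m + 1) * (2 * h)" by simp
    then have "real n \<le> real ((m + 1) * (2 * h))" by (rule of_nat_mono)
    also have "\<dots> = (real m + 1) * real (2 * h)" by (simp add: algebra_simps)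
    finally show ?thesis using h3 by (subst pos_divide_le_eq) simp_all
  qed
  ultimately have m_lower: "real n / \<kappa> - 1 \<le> real m" by linarith
  then have m_pos: "0 < m" using n(2) by (cases "m = 0") auto
  then show "0 < n div (2 * h)" by (simp add: m_def)
  have ch: "0.6 * ln (real n) \<le> c * real h" "c * real h \<le> 0.6 * ln (real n) + c"
    using h_lower h_upper c by (simp_all add: field_simps)
  \<comment> \<open>Five of the \<open>2 * h\<close> positions do not dominate, which is the source
    of \<open>5 * c\<close>.\<close>
  have "(1 - p) ^ (2 * h - 5) = exp (real (2 * h - 5) * - c)"
    unfolding q by (rule exp_of_nat_mult[symmetric])
  also have "real (2 * h - 5) * - c = 5 * c - 2 * (c * real h)"
    using h3 by (simp add: of_nat_diff algebra_simps)
  also have "exp (5 * c - 2 * (c * real h)) \<le> exp (5 * c - 1.2 * ln (real n))"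
    using ch(1) by simp
  finally have first: "real n * (1 - p) ^ (2 * h - 5) \<le> real n * exp (5 * c - 1.2 * ln (real n))"
    by (intro mult_left_mono) auto
  define \<beta> where "\<beta> = (1 / (1 - p)) ^ h"
  have "\<beta> = exp (c * real h)"
  proof -
    have "1 / (1 - p) = exp c" unfolding q by (simp add: exp_minus inverse_eq_divide)
    then show ?thesis unfolding \<beta>_def by (simp add: mult.commute[of c] exp_of_nat_mult)
  qed
  then have \<beta>: "\<beta> \<le> exp (0.6 * ln (real n) + c)" using ch(2) by simp
  have \<beta>1: "1 \<le> \<beta>" using p unfolding \<beta>_def by (intro one_le_power) simp
  have "(1 + (\<beta> - 1) / m) ^ (2 * h) \<le> exp ((\<beta> - 1) / m) ^ (2 * h)"
    using \<beta>1 by (intro power_mono exp_ge_add_one_self) auto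
  also have "\<dots> = exp (real (2 * h) * ((\<beta> - 1) / m))" by (rule exp_of_nat_mult[symmetric])
  also have "real (2 * h) * ((\<beta> - 1) / m) \<le> \<kappa> * (exp (0.6 * ln (real n) + c) / (real n / \<kappa> - 1))"
    using K\<kappa> \<beta> \<beta>1 m_lower n(2) by (intro mult_mono frac_le) auto
  finally have second: "((1 + (\<beta> - 1) / m) ^ (2 * h) - 1) / p ^ 5
      \<le> (exp (\<kappa> * exp (0.6 * ln (real n) + c) / (real n / \<kappa> - 1)) - 1) / p ^ 5"
    using p by (intro divide_right_mono) auto
  show "1 - 2 * (real n * exp (5 * c - 1.2 * ln (real n)))
        - (exp (\<kappa> * exp (0.6 * ln (real n) + c) / (real n / \<kappa> - 1)) - 1) / p ^ 5
      \<le> 1 - 2 * real n * (1 - p) ^ (2 * h - 5)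
        - ((1 + ((1 / (1 - p)) ^ h - 1) / real (n div (2 * h))) ^ (2 * h) - 1) / p ^ 5"
    using first second unfolding \<beta>_def m_def by linarith
qed

theorem corollary7p9:
  fixes p :: real
  assumes "0 < p" and "p < 1"
  shows "(\<lambda>n. measure_pmf.prob (random_graph n p)
           {E. \<forall>a. (\<forall>i \<in> {1..n}. a i \<ge> 2) \<longrightarrow>
                 \<not> level n (edge_ideal n E <+>\<^bsub>polynomial_ring n\<^esub> power_ideal n a
                             :: ('k::field) mpoly set)})
         \<longlonglongrightarrow> 1"
proof -
  define G where "G n = {E. \<forall>a. (\<forall>i \<in> {1..n}. a i \<ge> 2) \<longrightarrow>
    \<not> level n (edge_ideal n E <+>\<^bsub>polynomial_ring n\<^esub> power_ideal n a :: 'k mpoly set)}" for n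
  define c where "c = - ln (1 - p)"
  have c: "0 < c" using assms by (simp add: c_def)
  define \<kappa> where "\<kappa> n = 1.2 * ln (real n) / c + 2" for n
  define L where "L n = 1 - 2 * (real n * exp (5 * c - 1.2 * ln (real n)))
    - (exp (\<kappa> n * exp (0.6 * ln (real n) + c) / (real n / \<kappa> n - 1)) - 1) / p ^ 5" for n
  have bound: "L n \<le> measure_pmf.prob (random_graph n p) (G n)"
    if n: "2 < 0.6 * ln (real n) / c" "1 < real n / \<kappa> n - 1" for n
  proof -
    define h where "h = nat \<lceil>0.6 * ln (real n) / c\<rceil>"
    define m where "m = n div (2 * h)"
    note est = path_bound_estimate[OF assms n[unfolded c_def \<kappa>_def], folded c_def, folded \<kappa>_def h_def]
    have Km: "2 * h * m \<le> n" by (simp add: m_def)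
    have m0: "0 < m" using est(2) by (simp add: m_def)
    have "L n \<le> measure_pmf.prob (random_graph n p)
        (\<Union>f\<in>{..<2 * h} \<rightarrow>\<^sub>E {..<m}. dominating_path_event n (2 * h) m f)"
      using est(3) prob_exists_dominating_path[OF assms refl est(1) m0 Km] by (simp add: L_def m_def)
    also have "\<dots> \<le> measure_pmf.prob (random_graph n p) (G n)"
    \<comment> \<open>Inclusion of the events holds only on the support, where edges are pairs of
      vertices.\<close>
    proof (rule measure_pmf.finite_measure_mono_AE)
      have "E \<in> G n" if E: "E \<in> set_pmf (random_graph n p)"
        and f: "f \<in> {..<2 * h} \<rightarrow>\<^sub>E {..<m}" "E \<in> dominating_path_event n (2 * h) m f" for E f
        unfolding G_def
      proof (intro CollectI allI impI)
        fix a :: "nat \<Rightarrow> nat" assume a: "\<forall>i\<in>{1..n}. 2 \<le> a i"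
        have "5 \<le> 2 * h" using est(1) by simp
        from not_level_if_dominating_path_event[OF set_pmf_random_graph[OF E] a f(1) this Km f(2)]
        show "\<not> level n (edge_ideal n E <+>\<^bsub>polynomial_ring n\<^esub> power_ideal n a :: 'k mpoly set)" .
      qed
      then show "AE E in random_graph n p.
          E \<in> (\<Union>f\<in>{..<2 * h} \<rightarrow>\<^sub>E {..<m}. dominating_path_event n (2 * h) m f) \<longrightarrow> E \<in> G n"
        unfolding AE_measure_pmf_iff by blast
    qed auto
    finally show ?thesis .
  qed
  have "(\<lambda>n. measure_pmf.prob (random_graph n p) (G n)) \<longlonglongrightarrow> 1"
  proof (rule tendsto_sandwich)
    have "\<forall>\<^sub>F n :: nat in sequentially. 2 < 0.6 * ln (real n) / c"
      using c by real_asymp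
    moreover have "\<forall>\<^sub>F n :: nat in sequentially. 1 < real n / \<kappa> n - 1"
      using c unfolding \<kappa>_def by real_asymp
    ultimately show "\<forall>\<^sub>F n in sequentially. L n \<le> measure_pmf.prob (random_graph n p) (G n)"
      by eventually_elim (rule bound)
    \<comment> \<open>The domination error is of order n^(-0.2). The argument of the outer
      exponential is of order n^(-0.4) (ln n)^2, since \<kappa> grows like ln n. A factor r in place
      of 1.2 would give the powers n^(1 - r) and n^(r/2 - 1), which both decay for r between 1 and
      2.\<close>
    show "L \<longlonglongrightarrow> 1"
      using c assms(1) unfolding L_def \<kappa>_def by real_asymp
  qed auto
  then show ?thesis by (simp only: G_def)
qed

end
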